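(* Let $\mathbb{K}$ be an algebraically closed field of characteristic zero, let $\mathbb{G}$ be the Grassmannian of lines in $\mathbb{P}^3$ and let $\pi:\mathbb{G}\to\mathbb{P}^5$ be the Plücker embedding. Let $C_1,\dots,C_7\subset\mathbb{P}^5$ be the irreducible components (listed in the context) of the line scheme of the algebra $R$ with generators $x_1,x_2,x_3,x_4$ and relations $x_1x_2+x_2x_1$, $x_1x_3+x_4x_2$, $x_1x_4-x_3x_2$, $x_2x_3-x_4x_1$, $x_2x_4+x_3x_1$, $x_3x_4+x_4x_3$. Then: (i) for $1\le i\le4$, $\pi^{-1}(C_i)$ is the set of all lines of $\mathbb{P}^3$ contained in the hyperplane $H_i$, where $H_1=\mathcal{V}(x_1-x_2)$, $H_2=\mathcal{V}(x_1+x_2)$, $H_3=\mathcal{V}(x_3-x_4)$, $H_4=\mathcal{V}(x_3+x_4)$; (ii) $\pi^{-1}(C_5)=\mathcal{J}(E_{1,2},E_{3,4})$, $\pi^{-1}(C_6)=\mathcal{J}(E_{2,3},E_{1,4})$, $\pi^{-1}(C_7)=\mathcal{J}(E_{1,3},E_{2,4})$, where $E_{i,j}=H_i\cap H_j$.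
   Context: For the line $\ell$ through distinct points $[a_1:a_2:a_3:a_4]$ and $[b_1:b_2:b_3:b_4]$, $M_{ij}(\ell)=a_ib_j-a_jb_i$ and $\pi(\ell)=[M_{12}(\ell):M_{13}(\ell):M_{14}(\ell):M_{23}(\ell):M_{24}(\ell):M_{34}(\ell)]$; $\pi$ is an isomorphism onto $\mathcal{V}(P)$, $P=M_{12}M_{34}-M_{13}M_{24}+M_{14}M_{23}$. For disjoint subschemes $Y,Z$ of $\mathbb{P}^3$, $\mathcal{J}(Y,Z)$ is the subscheme of $\mathbb{G}$ whose closed points are the lines joining a point of $Y$ and a point of $Z$. The components of the line scheme are $C_1=\mathcal{V}(M_{12},M_{13}-M_{23},M_{14}-M_{24})$, $C_2=\mathcal{V}(M_{12},M_{13}+M_{23},M_{14}+M_{24})$, $C_3=\mathcal{V}(M_{34},M_{13}-M_{14},M_{23}-M_{24})$, $C_4=\mathcal{V}(M_{34},M_{13}+M_{14},M_{23}+M_{24})$, $C_5=\mathcal{V}(M_{12},M_{34},P)$, $C_6=\mathcal{V}(M_{14}-M_{23},M_{13}-M_{24},P)$, $C_7=\mathcal{V}(M_{14}+M_{23},M_{13}+M_{24},P)$. $\mathcal{V}(\cdot)$ denotes zero locus. *)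

theory Defs
  imports "HOL-Analysis.Cartesian_Space" "HOL-Computational_Algebra.Polynomial"
begin

text \<open>A point of projective space is the one-dimensional subspace of its representatives, and
  \<^term>\<open>vec.span {a}\<close> is the point with homogeneous coordinates \<open>a\<close>. A line is the set of
  the points on it.\<close>

definition proj_space :: "('k::field ^ 'n) set set" where
  "proj_space = {vec.span {a} | a. a \<noteq> 0}"

definition line_through :: "('k::field ^ 'n) set \<Rightarrow> ('k ^ 'n) set \<Rightarrow> ('k ^ 'n) set set" where
  "line_through p q = {r \<in> proj_space. r \<subseteq> vec.span (p \<union> q)}"

definition proj_lines :: "('k::field ^ 'n) set set set" where
  "proj_lines = {line_through p q | p q. p \<in> proj_space \<and> q \<in> proj_space \<and> p \<noteq> q}"

text \<open>The zero locus is meant for families of homogeneous polynomials, given as functions of the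
  coordinate vector. For these, vanishing at one representative of a point amounts to vanishing
  at all of them.\<close>

definition zero_locus :: "('k::field ^ 'n \<Rightarrow> 'k) set \<Rightarrow> ('k ^ 'n) set set" where
  "zero_locus F = {p \<in> proj_space. \<forall>f \<in> F. \<forall>v \<in> p - {0}. f v = 0}"

text \<open>The closed points of \<open>\<J>(Y, Z)\<close>; this is a set of lines when \<open>Y\<close> and \<open>Z\<close> are disjoint.\<close>

definition joining_lines ::
    "('k::field ^ 'n) set set \<Rightarrow> ('k ^ 'n) set set \<Rightarrow> ('k ^ 'n) set set set" where
  "joining_lines Y Z = {line_through p q | p q. p \<in> Y \<and> q \<in> Z}"

text \<open>In the index type \<open>4\<close> the numeral \<open>4\<close> equals \<open>0\<close>, and likewise for \<open>6\<close>, so the indices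
  \<open>1, \<dots>, 4\<close> and \<open>1, \<dots>, 6\<close> are pairwise distinct and exhaust these types.\<close>

definition minor2 :: "'k::field ^ 4 \<Rightarrow> 'k ^ 4 \<Rightarrow> 4 \<Rightarrow> 4 \<Rightarrow> 'k" where
  "minor2 a b i j = a $ i * b $ j - a $ j * b $ i"

definition plucker_vec :: "'k::field ^ 4 \<Rightarrow> 'k ^ 4 \<Rightarrow> 'k ^ 6" where
  "plucker_vec a b = vector
     [minor2 a b 1 2, minor2 a b 1 3, minor2 a b 1 4,
      minor2 a b 2 3, minor2 a b 2 4, minor2 a b 3 4]"

text \<open>The choice of the two points on the line is immaterial: see \<open>plucker_line_through\<close> below.\<close>

definition plucker :: "('k::field ^ 4) set set \<Rightarrow> ('k ^ 6) set" where
  "plucker L = (THE m. \<exists>a b. a \<noteq> 0 \<and> b \<noteq> 0 \<and> vec.span {a} \<noteq> vec.span {b} \<and>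
     L = line_through (vec.span {a}) (vec.span {b}) \<and> m = vec.span {plucker_vec a b})"

abbreviation M12 :: "'k::field ^ 6 \<Rightarrow> 'k" where "M12 m \<equiv> m $ 1"
abbreviation M13 :: "'k::field ^ 6 \<Rightarrow> 'k" where "M13 m \<equiv> m $ 2"
abbreviation M14 :: "'k::field ^ 6 \<Rightarrow> 'k" where "M14 m \<equiv> m $ 3"
abbreviation M23 :: "'k::field ^ 6 \<Rightarrow> 'k" where "M23 m \<equiv> m $ 4"
abbreviation M24 :: "'k::field ^ 6 \<Rightarrow> 'k" where "M24 m \<equiv> m $ 5"
abbreviation M34 :: "'k::field ^ 6 \<Rightarrow> 'k" where "M34 m \<equiv> m $ 6"

definition plucker_poly :: "'k::field ^ 6 \<Rightarrow> 'k" where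
  "plucker_poly m = M12 m * M34 m - M13 m * M24 m + M14 m * M23 m"

text \<open>The components \<open>C\<^sub>1, \<dots>, C\<^sub>7\<close> of the line scheme; only \<open>1 \<le> i \<le> 7\<close> is meaningful.\<close>

definition component :: "nat \<Rightarrow> ('k::field ^ 6) set set" where
  "component i = zero_locus (
     [{\<lambda>m. M12 m, \<lambda>m. M13 m - M23 m, \<lambda>m. M14 m - M24 m},
      {\<lambda>m. M12 m, \<lambda>m. M13 m + M23 m, \<lambda>m. M14 m + M24 m},
      {\<lambda>m. M34 m, \<lambda>m. M13 m - M14 m, \<lambda>m. M23 m - M24 m},
      {\<lambda>m. M34 m, \<lambda>m. M13 m + M14 m, \<lambda>m. M23 m + M24 m},
      {\<lambda>m. M12 m, \<lambda>m. M34 m, plucker_poly},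
      {\<lambda>m. M14 m - M23 m, \<lambda>m. M13 m - M24 m, plucker_poly},
      {\<lambda>m. M14 m + M23 m, \<lambda>m. M13 m + M24 m, plucker_poly}] ! (i - 1))"

text \<open>The hyperplanes \<open>H\<^sub>1, \<dots>, H\<^sub>4\<close>; only \<open>1 \<le> i \<le> 4\<close> is meaningful.\<close>

definition hyperplane :: "nat \<Rightarrow> ('k::field ^ 4) set set" where
  "hyperplane i = zero_locus {
     [\<lambda>x. x $ 1 - x $ 2, \<lambda>x. x $ 1 + x $ 2, \<lambda>x. x $ 3 - x $ 4, \<lambda>x. x $ 3 + x $ 4] ! (i - 1)}"

definition edge :: "nat \<Rightarrow> nat \<Rightarrow> ('k::field ^ 4) set set" where
  "edge i j = hyperplane i \<inter> hyperplane j"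

lemma plucker_vec_nth [simp]:
  "M12 (plucker_vec a b) = minor2 a b 1 2" "M13 (plucker_vec a b) = minor2 a b 1 3"
  "M14 (plucker_vec a b) = minor2 a b 1 4" "M23 (plucker_vec a b) = minor2 a b 2 3"
  "M24 (plucker_vec a b) = minor2 a b 2 4" "M34 (plucker_vec a b) = minor2 a b 3 4"
  by (simp_all add: plucker_vec_def vector_def)

lemma exhaust_6:
  fixes i :: 6
  shows "i = 1 \<or> i = 2 \<or> i = 3 \<or> i = 4 \<or> i = 5 \<or> i = 6"
proof (induct i)
  case (of_int z)
  then have "z = 0 \<or> z = 1 \<or> z = 2 \<or> z = 3 \<or> z = 4 \<or> z = 5" by auto
  then show ?case by auto
qed

lemma vec6_eq_iff:
  fixes m n :: "'k ^ 6"
  shows "m = n \<longleftrightarrow> m $ 1 = n $ 1 \<and> m $ 2 = n $ 2 \<and> m $ 3 = n $ 3 \<and>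
    m $ 4 = n $ 4 \<and> m $ 5 = n $ 5 \<and> m $ 6 = n $ 6"
proof
  assume eq: "m $ 1 = n $ 1 \<and> m $ 2 = n $ 2 \<and> m $ 3 = n $ 3 \<and>
    m $ 4 = n $ 4 \<and> m $ 5 = n $ 5 \<and> m $ 6 = n $ 6"
  have "m $ i = n $ i" for i
    using exhaust_6[of i] eq by (elim disjE) simp_all
  then show "m = n" by (simp add: vec_eq_iff)
qed simp

lemma plucker_vec_comb:
  "plucker_vec (x *s a + y *s b) (z *s a + w *s b) = (x * w - y * z) *s plucker_vec a b"
  unfolding vec6_eq_iff by (simp add: minor2_def algebra_simps)

lemma span_pair: "vec.span {a, b} = {x *s a + y *s b | x y. True}" for a b :: "'k::field ^ 'n"
proof -
  have "vec.span {a, b} = vec.span ({a} \<union> {b})" by (simp add: insert_commute)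
  also have "\<dots> = {x *s a + y *s b | x y. True}"
    unfolding vec.span_Un vec.span_singleton by blast
  finally show ?thesis .
qed

lemma span_singleton_scale:
  fixes a :: "'k::field ^ 'n"
  assumes "c \<noteq> 0"
  shows "vec.span {c *s a} = vec.span {a}"
proof (rule antisym)
  have "a = inverse c *s (c *s a)" using assms by (simp add: vector_smult_assoc)
  then have "a \<in> vec.span {c *s a}"
    by (metis singletonI vec.span_base vec.span_scale)
  then show "vec.span {a} \<subseteq> vec.span {c *s a}" by (intro vec.span_minimal) auto
  show "vec.span {c *s a} \<subseteq> vec.span {a}"
    by (intro vec.span_minimal) (auto intro: vec.span_scale vec.span_base)
qed

lemma minors_zero_imp:
  fixes a b :: "'k::field ^ 4"
  assumes a: "a \<noteq> 0" and m: "plucker_vec a b = 0"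
  shows "\<exists>c. b = c *s a"
proof -
  have eq: "a $ i * b $ j = a $ j * b $ i" for i j
  proof -
    have "a $ 1 * b $ 2 = a $ 2 * b $ 1" "a $ 1 * b $ 3 = a $ 3 * b $ 1"
      "a $ 1 * b $ 4 = a $ 4 * b $ 1" "a $ 2 * b $ 3 = a $ 3 * b $ 2"
      "a $ 2 * b $ 4 = a $ 4 * b $ 2" "a $ 3 * b $ 4 = a $ 4 * b $ 3"
      using m unfolding vec6_eq_iff plucker_vec_nth minor2_def by simp_all
    then have "\<forall>i j. a $ i * b $ j = a $ j * b $ i"
      unfolding forall_4 by (intro conjI) (simp_all only:)
    then show ?thesis by blast
  qed
  obtain i where i: "a $ i \<noteq> 0" using a by (auto simp: vec_eq_iff)
  have "b = (b $ i / a $ i) *s a"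
    unfolding vec_eq_iff
  proof
    fix j
    show "b $ j = ((b $ i / a $ i) *s a) $ j"
      using eq[of i j] i by (simp add: nonzero_eq_divide_eq mult.commute)
  qed
  then show ?thesis by blast
qed

lemma plucker_vec_nonzero:
  fixes a b :: "'k::field ^ 4"
  assumes "a \<noteq> 0" "b \<noteq> 0" "vec.span {a} \<noteq> vec.span {b}"
  shows "plucker_vec a b \<noteq> 0"
proof
  assume "plucker_vec a b = 0"
  then obtain c where c: "b = c *s a" using minors_zero_imp assms by blast
  then have "c \<noteq> 0" using assms(2) by auto
  then show False using assms(3) c span_singleton_scale by metis
qed

lemma line_through_span:
  "line_through (vec.span {a}) (vec.span {b}) = {r \<in> proj_space. r \<subseteq> vec.span {a, b}}"
proof -
  have "vec.span (vec.span {a} \<union> vec.span {b}) = vec.span {a, b}"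
  proof (rule antisym)
    have "vec.span {a} \<subseteq> vec.span {a, b}" "vec.span {b} \<subseteq> vec.span {a, b}"
      by (intro vec.span_mono; blast)+
    then show "vec.span (vec.span {a} \<union> vec.span {b}) \<subseteq> vec.span {a, b}"
      by (intro vec.span_minimal) auto
    have "a \<in> vec.span {a}" "b \<in> vec.span {b}" by (simp_all add: vec.span_base)
    then show "vec.span {a, b} \<subseteq> vec.span (vec.span {a} \<union> vec.span {b})"
      by (intro vec.span_mono) blast
  qed
  then show ?thesis by (simp add: line_through_def)
qed

lemma plucker_line_through:
  fixes a b :: "'k::field ^ 4"
  assumes ab: "a \<noteq> 0" "b \<noteq> 0" "vec.span {a} \<noteq> vec.span {b}"
  shows "plucker (line_through (vec.span {a}) (vec.span {b})) = vec.span {plucker_vec a b}"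
  unfolding plucker_def
proof (rule the_equality)
  show "\<exists>c d. c \<noteq> 0 \<and> d \<noteq> 0 \<and> vec.span {c} \<noteq> vec.span {d} \<and>
      line_through (vec.span {a}) (vec.span {b}) = line_through (vec.span {c}) (vec.span {d}) \<and>
      vec.span {plucker_vec a b} = vec.span {plucker_vec c d}"
    using ab by blast
next
  fix m
  assume "\<exists>c d. c \<noteq> 0 \<and> d \<noteq> 0 \<and> vec.span {c} \<noteq> vec.span {d} \<and>
      line_through (vec.span {a}) (vec.span {b}) = line_through (vec.span {c}) (vec.span {d}) \<and>
      m = vec.span {plucker_vec c d}"
  then obtain c d where cd: "c \<noteq> 0" "d \<noteq> 0" "vec.span {c} \<noteq> vec.span {d}"
    and L: "line_through (vec.span {a}) (vec.span {b}) = line_through (vec.span {c}) (vec.span {d})"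
    and m: "m = vec.span {plucker_vec c d}" by blast
  have in_span: "e \<in> vec.span {a, b}" if "e = c \<or> e = d" for e
  proof -
    have "vec.span {e} \<in> line_through (vec.span {c}) (vec.span {d})"
    proof -
      have "vec.span {e} \<in> proj_space" using that cd unfolding proj_space_def by blast
      moreover have "vec.span {e} \<subseteq> vec.span {c, d}"
        using that by (intro vec.span_mono) blast
      ultimately show ?thesis unfolding line_through_span by simp
    qed
    then have "vec.span {e} \<in> line_through (vec.span {a}) (vec.span {b})"
      by (simp only: L)
    then have "vec.span {e} \<subseteq> vec.span {a, b}"
      unfolding line_through_span by simp
    moreover have "e \<in> vec.span {e}" by (simp add: vec.span_base)
    ultimately show ?thesis by blast
  qed
  obtain x y where c: "c = x *s a + y *s b" using in_span[of c] unfolding span_pair by blast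
  obtain z w where d: "d = z *s a + w *s b" using in_span[of d] unfolding span_pair by blast
  have eq: "plucker_vec c d = (x * w - y * z) *s plucker_vec a b"
    unfolding c d by (rule plucker_vec_comb)
  then have "x * w - y * z \<noteq> 0" using plucker_vec_nonzero[OF cd] by auto
  then show "m = vec.span {plucker_vec a b}" unfolding m eq by (rule span_singleton_scale)
qed

lemma edges_disjoint:
  "edge 1 2 \<inter> edge 3 4 = ({} :: ('k::field_char_0 ^ 4) set set)"
  "edge 2 3 \<inter> edge 1 4 = ({} :: ('k ^ 4) set set)"
  "edge 1 3 \<inter> edge 2 4 = ({} :: ('k ^ 4) set set)"
proof -
  have "hyperplane 1 \<inter> hyperplane 2 \<inter> hyperplane 3 \<inter> hyperplane 4 = ({} :: ('k ^ 4) set set)"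
  proof (intro equals0I)
    fix p :: "('k ^ 4) set"
    assume p: "p \<in> hyperplane 1 \<inter> hyperplane 2 \<inter> hyperplane 3 \<inter> hyperplane 4"
    then obtain a where a: "a \<noteq> 0" "a \<in> p"
      by (auto simp: hyperplane_def zero_locus_def proj_space_def intro: vec.span_base)
    then have "a $ 1 - a $ 2 = 0" "a $ 1 + a $ 2 = 0" "a $ 3 - a $ 4 = 0" "a $ 3 + a $ 4 = 0"
      using p by (auto simp: hyperplane_def zero_locus_def numeral_eq_Suc)
    then have "a = 0" by (simp add: vec_eq_iff forall_4)
    with a show False by blast
  qed
  then show "edge 1 2 \<inter> edge 3 4 = ({} :: ('k ^ 4) set set)"
    "edge 2 3 \<inter> edge 1 4 = ({} :: ('k ^ 4) set set)"
    "edge 1 3 \<inter> edge 2 4 = ({} :: ('k ^ 4) set set)"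
    unfolding edge_def by blast+
qed

end

theory Submission
  imports Defs
begin

text \<open>If \<open>f\<close>, \<open>g\<close> are linear forms, the line through \<open>a\<close> and \<open>b\<close> meets \<open>f = g = 0\<close> exactly when
  \<open>f a * g b - g a * f b = 0\<close>, which is a linear equation in the Pluecker coordinates; the two
  such equations for a pair of opposite edges cut out \<open>C\<^sub>5\<close>, \<open>C\<^sub>6\<close> and \<open>C\<^sub>7\<close>. For \<open>C\<^sub>1, \<dots>, C\<^sub>4\<close>
  the equations say \<open>f a *s b = f b *s a\<close>, and so \<open>f a = f b = 0\<close> because \<open>a\<close> and \<open>b\<close> are
  linearly independent.\<close>

section \<open>Linear forms and independence of representatives of distinct points\<close>

abbreviation linear_form :: "('k::field ^ 'n \<Rightarrow> 'k) \<Rightarrow> bool" where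
  "linear_form \<equiv> Vector_Spaces.linear (*s) (*)"

lemma linear_form_comb:
  assumes "linear_form f"
  shows "f (x *s a + y *s b) = x * f a + y * f b"
  using assms by (simp add: Vector_Spaces.linear_iff)

lemma linear_form_scale:
  assumes "linear_form f"
  shows "f (x *s a) = x * f a"
  using assms by (simp add: Vector_Spaces.linear_iff)

lemma linear_formI:
  fixes f :: "'k::field ^ 'n \<Rightarrow> 'k"
  assumes "\<And>a b. f (a + b) = f a + f b" "\<And>c a. f (c *s a) = c * f a"
  shows "linear_form f"
  unfolding Vector_Spaces.linear_iff
  using assms vec.vector_space_axioms vector_space_over_itself.vector_space_axioms by blast

lemma span_singleton_eq_imp:
  fixes a b :: "'k::field ^ 'n"
  assumes "y *s b = x *s a" "y \<noteq> 0" "b \<noteq> 0"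
  shows "vec.span {a} = vec.span {b}"
proof -
  have "b = (inverse y * x) *s a"
    using assms by (metis vector_smult_assoc left_inverse vector_smult_lid)
  then show ?thesis
    using assms(3) span_singleton_scale by (metis vector_smult_lzero)
qed

text \<open>Distinct projective points have linearly independent representatives: a relation with
  \<open>y\<close> nonzero would make \<open>b\<close> a multiple of \<open>a\<close>, and then the
  two spans would agree.\<close>

lemma comb_eq_zero_iff:
  fixes a b :: "'k::field ^ 'n"
  assumes ab: "a \<noteq> 0" "b \<noteq> 0" "vec.span {a} \<noteq> vec.span {b}"
  shows "x *s a + y *s b = 0 \<longleftrightarrow> x = 0 \<and> y = 0"
proof
  assume eq: "x *s a + y *s b = 0"
  then have "y *s b = (- x) *s a"
    by (simp add: add_eq_0_iff)
  then have "y = 0" using span_singleton_eq_imp ab by metis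
  with eq ab show "x = 0 \<and> y = 0" by simp
qed simp

lemma proj_lines_cases:
  assumes "L \<in> proj_lines"
  obtains a b where "a \<noteq> 0" "b \<noteq> 0" "vec.span {a} \<noteq> vec.span {b}"
    "L = line_through (vec.span {a}) (vec.span {b})"
  using assms unfolding proj_lines_def proj_space_def by blast

section \<open>Zero loci of homogeneous families, and lines determined by two points\<close>

lemma zero_locus_Int: "zero_locus F \<inter> zero_locus G = zero_locus (F \<union> G)"
  unfolding zero_locus_def by blast

text \<open>The assumption \<open>hom\<close> asks only that vanishing survive scaling, so that one
  criterion serves both linear forms and the quadric \<open>plucker_poly\<close>.\<close>

lemma span_in_zero_locus_iff:
  fixes a :: "'k::field ^ 'n"
  assumes "a \<noteq> 0" and hom: "\<And>f c. f \<in> F \<Longrightarrow> f a = 0 \<Longrightarrow> f (c *s a) = 0"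
  shows "vec.span {a} \<in> zero_locus F \<longleftrightarrow> (\<forall>f\<in>F. f a = 0)"
proof
  assume "vec.span {a} \<in> zero_locus F"
  moreover have "a \<in> vec.span {a} - {0}" using assms(1) by (simp add: vec.span_base)
  ultimately show "\<forall>f\<in>F. f a = 0" unfolding zero_locus_def by blast
next
  assume zero: "\<forall>f\<in>F. f a = 0"
  have "vec.span {a} \<in> proj_space" using assms(1) unfolding proj_space_def by blast
  with zero hom show "vec.span {a} \<in> zero_locus F"
    unfolding zero_locus_def vec.span_singleton by blast
qed

lemma span_in_zero_locus_linear:
  assumes "a \<noteq> 0" "\<And>f. f \<in> F \<Longrightarrow> linear_form f"
  shows "vec.span {a} \<in> zero_locus F \<longleftrightarrow> (\<forall>f\<in>F. f a = 0)"
  using assms by (intro span_in_zero_locus_iff) (simp_all add: linear_form_scale)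

lemma line_through_eqI:
  fixes a b c d :: "'k::field ^ 'n"
  assumes cd: "c \<noteq> 0" "d \<noteq> 0" "vec.span {c} \<noteq> vec.span {d}"
    and c: "c = x *s a + y *s b" and d: "d = z *s a + w *s b"
  shows "line_through (vec.span {a}) (vec.span {b}) = line_through (vec.span {c}) (vec.span {d})"
proof -
  define D where "D = x * w - y * z"
  \<comment> \<open>Multiplying by the adjugate of the matrix with rows \<open>(x, y)\<close> and
    \<open>(z, w)\<close> expresses \<open>a\<close> and \<open>b\<close>, up to the factor
    \<open>D\<close>, through \<open>c\<close> and \<open>d\<close>.\<close>
  have a: "D *s a = w *s c + (- y) *s d" and b: "D *s b = (- z) *s c + x *s d"
    unfolding c d D_def by (simp_all add: vec_eq_iff algebra_simps)
  \<comment> \<open>If \<open>D\<close> were zero, these would be two relations between the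
    independent vectors \<open>c\<close> and \<open>d\<close>; all entries of the matrix would
    vanish, and with them \<open>c\<close>.\<close>
  have "D \<noteq> 0"
  proof
    assume "D = 0"
    then have "x = 0 \<and> y = 0"
      using a b comb_eq_zero_iff[OF cd, of w "- y"] comb_eq_zero_iff[OF cd, of "- z" x] by simp
    with c cd show False by simp
  qed
  then have "a = inverse D *s (D *s a)" "b = inverse D *s (D *s b)"
    by (simp_all add: vector_smult_assoc)
  moreover have "D *s a \<in> vec.span {c, d}" "D *s b \<in> vec.span {c, d}"
    unfolding a b span_pair by blast+
  ultimately have "a \<in> vec.span {c, d}" "b \<in> vec.span {c, d}"
    by (metis vec.span_scale)+
  moreover have "c \<in> vec.span {a, b}" "d \<in> vec.span {a, b}"
    unfolding span_pair using c d by blast+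
  ultimately have "vec.span {a, b} = vec.span {c, d}"
    by (intro antisym vec.span_minimal) auto
  then show ?thesis unfolding line_through_span by simp
qed

section \<open>Lines inside a hyperplane and lines joining two linear loci\<close>

lemma span_in_line_through_iff:
  assumes "e \<noteq> 0"
  shows "vec.span {e} \<in> line_through (vec.span {a}) (vec.span {b}) \<longleftrightarrow> e \<in> vec.span {a, b}"
proof -
  have "vec.span {e} \<subseteq> vec.span {a, b} \<longleftrightarrow> e \<in> vec.span {a, b}"
    by (metis insert_subset empty_subsetI vec.span_base vec.span_minimal vec.subspace_span
        singletonI subsetD)
  then show ?thesis
    using assms unfolding line_through_span proj_space_def by blast
qed

lemma line_subset_zero_locus_iff:
  assumes f: "linear_form f" and ab: "a \<noteq> 0" "b \<noteq> 0"
  shows "line_through (vec.span {a}) (vec.span {b}) \<subseteq> zero_locus {f} \<longleftrightarrow> f a = 0 \<and> f b = 0"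
proof
  assume sub: "line_through (vec.span {a}) (vec.span {b}) \<subseteq> zero_locus {f}"
  have "vec.span {a} \<in> zero_locus {f}" "vec.span {b} \<in> zero_locus {f}"
    using sub ab by (auto intro!: subsetD[OF sub] simp: span_in_line_through_iff vec.span_base)
  then show "f a = 0 \<and> f b = 0"
    using span_in_zero_locus_linear[of a "{f}"] span_in_zero_locus_linear[of b "{f}"] ab f by simp
next
  assume "f a = 0 \<and> f b = 0"
  then have "f v = 0" if "v \<in> vec.span {a, b}" for v
    using that f unfolding span_pair by (auto simp: linear_form_comb)
  then show "line_through (vec.span {a}) (vec.span {b}) \<subseteq> zero_locus {f}"
    unfolding line_through_span zero_locus_def by blast
qed

text \<open>The right side lists the coordinates of the contraction of the bivector of
  \<open>a\<close> and \<open>b\<close> with \<open>f\<close>. For a linear form these are linear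
  combinations of the minors, which is how the equations of \<open>component\<close> 1 to 4
  arise.\<close>

lemma linear_form_both_zero_iff:
  assumes ab: "a \<noteq> 0" "b \<noteq> 0" "vec.span {a} \<noteq> vec.span {b}"
  shows "f a = 0 \<and> f b = 0 \<longleftrightarrow> (\<forall>i. f a * b $ i - f b * a $ i = 0)"
proof
  assume "\<forall>i. f a * b $ i - f b * a $ i = 0"
  then have "(- f b) *s a + f a *s b = 0" by (simp add: vec_eq_iff)
  then show "f a = 0 \<and> f b = 0" using comb_eq_zero_iff[OF ab, of "- f b" "f a"] by simp
qed simp

text \<open>A homogeneous system of two equations in \<open>x\<close> and \<open>y\<close> with zero
  determinant has a nontrivial solution, and independence of \<open>a\<close> and \<open>b\<close>
  turns it into a nonzero vector.\<close>

lemma common_zero_on_line: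
  assumes f: "linear_form f" and g: "linear_form g"
    and ab: "a \<noteq> 0" "b \<noteq> 0" "vec.span {a} \<noteq> vec.span {b}"
    and eq: "f a * g b - g a * f b = 0"
  obtains x y where "x *s a + y *s b \<noteq> 0" "f (x *s a + y *s b) = 0" "g (x *s a + y *s b) = 0"
proof -
  have "\<exists>x y. (x \<noteq> 0 \<or> y \<noteq> 0) \<and> x * f a + y * f b = 0 \<and> x * g a + y * g b = 0"
  proof (cases "f a = 0 \<and> f b = 0")
    case True
    show ?thesis
    proof (cases "g a = 0 \<and> g b = 0")
      case True
      with \<open>f a = 0 \<and> f b = 0\<close> show ?thesis by (intro exI[of _ 1]) simp
    next
      case False
      with True show ?thesis by (intro exI[of _ "g b"] exI[of _ "- g a"]) (auto simp: algebra_simps)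
    qed
  next
    case False
    with eq show ?thesis
      \<comment> \<open>The pair \<open>(f b, - f a)\<close> solves the first equation and is
        nonzero; \<open>eq\<close> says exactly that it solves the second.\<close>
      by (intro exI[of _ "f b"] exI[of _ "- f a"]) (auto simp: algebra_simps)
  qed
  then show ?thesis
    using that comb_eq_zero_iff[OF ab] linear_form_comb[OF f] linear_form_comb[OF g] by metis
qed

lemma line_in_joining_lines_iff:
  fixes f g h k :: "'k::field ^ 'n \<Rightarrow> 'k"
  assumes lin: "linear_form f" "linear_form g" "linear_form h" "linear_form k"
    and disj: "zero_locus {f, g} \<inter> zero_locus {h, k} = {}"
    and ab: "a \<noteq> 0" "b \<noteq> 0" "vec.span {a} \<noteq> vec.span {b}"
  shows "line_through (vec.span {a}) (vec.span {b})
      \<in> joining_lines (zero_locus {f, g}) (zero_locus {h, k}) \<longleftrightarrow>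
    f a * g b - g a * f b = 0 \<and> h a * k b - k a * h b = 0" (is "?L \<longleftrightarrow> ?R")
proof
  assume ?L
  then obtain c d where cd: "c \<noteq> 0" "d \<noteq> 0"
    "vec.span {c} \<in> zero_locus {f, g}" "vec.span {d} \<in> zero_locus {h, k}"
    and L: "line_through (vec.span {a}) (vec.span {b}) = line_through (vec.span {c}) (vec.span {d})"
    unfolding joining_lines_def zero_locus_def proj_space_def by blast
  have zero: "f c = 0" "g c = 0" "h d = 0" "k d = 0"
    using span_in_zero_locus_linear[of c "{f, g}"] span_in_zero_locus_linear[of d "{h, k}"] cd lin
    by auto
  have "a \<in> vec.span {c, d}" "b \<in> vec.span {c, d}"
    using span_in_line_through_iff[of _ c d] span_in_line_through_iff[of _ a b] ab L
    by (auto simp: vec.span_base)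
  then obtain x y z w where "a = x *s c + y *s d" "b = z *s c + w *s d"
    unfolding span_pair by blast
  \<comment> \<open>Since \<open>f\<close> and \<open>g\<close> vanish at \<open>c\<close>, the
    pairs of their values at \<open>a\<close> and at \<open>b\<close> are both multiples of the pair
    at \<open>d\<close>, so their determinant is zero. The same holds for \<open>h\<close> and
    \<open>k\<close>, with \<open>c\<close> and \<open>d\<close> exchanged.\<close>
  then show ?R by (simp add: linear_form_comb lin zero)
next
  assume R: ?R
  obtain x y where c: "x *s a + y *s b \<noteq> 0" "f (x *s a + y *s b) = 0" "g (x *s a + y *s b) = 0"
    using common_zero_on_line R lin ab by metis
  obtain z w where d: "z *s a + w *s b \<noteq> 0" "h (z *s a + w *s b) = 0" "k (z *s a + w *s b) = 0"
    using common_zero_on_line R lin ab by metis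
  have in_locus: "vec.span {x *s a + y *s b} \<in> zero_locus {f, g}"
    "vec.span {z *s a + w *s b} \<in> zero_locus {h, k}"
    using span_in_zero_locus_linear[of "x *s a + y *s b" "{f, g}"]
      span_in_zero_locus_linear[of "z *s a + w *s b" "{h, k}"] c d lin by auto
  \<comment> \<open>Disjointness separates the two points found on the line, so they determine
    it.\<close>
  with disj have "vec.span {x *s a + y *s b} \<noteq> vec.span {z *s a + w *s b}" by auto
  then have "line_through (vec.span {a}) (vec.span {b}) =
      line_through (vec.span {x *s a + y *s b}) (vec.span {z *s a + w *s b})"
    using c d by (intro line_through_eqI) auto
  with in_locus show ?L unfolding joining_lines_def by blast
qed

text \<open>Disjointness excludes the degenerate case \<open>p = q\<close>, in which
  \<open>line_through p q\<close> is a single point.\<close>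

lemma joining_lines_subset:
  assumes "zero_locus F \<inter> zero_locus G = {}"
  shows "joining_lines (zero_locus F) (zero_locus G) \<subseteq> proj_lines"
proof
  fix L assume "L \<in> joining_lines (zero_locus F) (zero_locus G)"
  then obtain p q where L: "L = line_through p q" and pq: "p \<in> zero_locus F" "q \<in> zero_locus G"
    unfolding joining_lines_def by blast
  with assms have "p \<noteq> q" by blast
  moreover have "p \<in> proj_space" "q \<in> proj_space"
    using pq unfolding zero_locus_def by simp_all
  ultimately show "L \<in> proj_lines" unfolding L proj_lines_def by blast
qed

section \<open>Transfer of conditions on lines to Pluecker coordinates\<close>

lemma plucker_in_zero_locus_iff:
  assumes ab: "a \<noteq> 0" "b \<noteq> 0" "vec.span {a} \<noteq> vec.span {b}"
    and lin: "\<And>f. f \<in> F \<Longrightarrow> f = plucker_poly \<or> linear_form f"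
  shows "plucker (line_through (vec.span {a}) (vec.span {b})) \<in> zero_locus F \<longleftrightarrow>
    (\<forall>f\<in>F. f (plucker_vec a b) = 0)"
proof -
  have "plucker_poly (c *s m) = c^2 * plucker_poly m" for c :: 'a and m
    by (simp add: plucker_poly_def power2_eq_square algebra_simps)
  then have "f (c *s plucker_vec a b) = 0" if "f \<in> F" "f (plucker_vec a b) = 0" for f c
    using lin[OF that(1)] that(2) by (auto simp: linear_form_scale)
  then show ?thesis
    unfolding plucker_line_through[OF ab]
    by (intro span_in_zero_locus_iff plucker_vec_nonzero[OF ab])
qed

text \<open>The Pluecker relation: on Pluecker vectors, the conditions for \<open>component\<close>
  5 to 7 become two linear ones.\<close>

lemma plucker_poly_plucker_vec [simp]: "plucker_poly (plucker_vec a b) = 0"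
  by (simp add: plucker_poly_def minor2_def algebra_simps)

lemma linear_form_coord:
  "linear_form (\<lambda>x :: 'k::field ^ 'n. x $ i)"
  "linear_form (\<lambda>x :: 'k::field ^ 'n. x $ i + x $ j)"
  "linear_form (\<lambda>x :: 'k::field ^ 'n. x $ i - x $ j)"
  by (auto intro!: linear_formI simp: algebra_simps)

text \<open>Reduces the claim for a hyperplane to \<open>eq\<close>, a comparison of explicit
  equations in the coordinates of \<open>a\<close> and \<open>b\<close>.\<close>

lemma plucker_vimage_hyperplane:
  fixes f :: "'k::field ^ 4 \<Rightarrow> 'k"
  assumes f: "linear_form f" and F: "\<And>g. g \<in> F \<Longrightarrow> g = plucker_poly \<or> linear_form g"
    and eq: "\<And>a b. (\<forall>g\<in>F. g (plucker_vec a b) = 0) \<longleftrightarrow> (\<forall>i. f a * b $ i - f b * a $ i = 0)"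
  shows "plucker -` zero_locus F \<inter> proj_lines = {L \<in> proj_lines. L \<subseteq> zero_locus {f}}"
proof -
  have "plucker L \<in> zero_locus F \<longleftrightarrow> L \<subseteq> zero_locus {f}" if "L \<in> proj_lines" for L
    using that
  proof (cases rule: proj_lines_cases)
    case (1 a b)
    then show ?thesis
      using plucker_in_zero_locus_iff[OF 1(1-3) F] line_subset_zero_locus_iff[OF f 1(1,2)]
        linear_form_both_zero_iff[OF 1(1-3)] eq[of a b] by (simp only:)
  qed
  then show ?thesis by blast
qed

text \<open>The counterpart for opposite edges: \<open>eq\<close> compares the equations in
  \<open>F\<close> with the two determinants that detect whether the line meets each edge.\<close>

lemma plucker_vimage_joining_lines:
  fixes f g h k :: "'k::field ^ 4 \<Rightarrow> 'k"
  assumes lin: "linear_form f" "linear_form g" "linear_form h" "linear_form k"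
    and disj: "zero_locus {f, g} \<inter> zero_locus {h, k} = {}"
    and F: "\<And>q. q \<in> F \<Longrightarrow> q = plucker_poly \<or> linear_form q"
    and eq: "\<And>a b. (\<forall>q\<in>F. q (plucker_vec a b) = 0) \<longleftrightarrow>
      f a * g b - g a * f b = 0 \<and> h a * k b - k a * h b = 0"
  shows "plucker -` zero_locus F \<inter> proj_lines
    = joining_lines (zero_locus {f, g}) (zero_locus {h, k})"
proof -
  have "plucker L \<in> zero_locus F \<longleftrightarrow> L \<in> joining_lines (zero_locus {f, g}) (zero_locus {h, k})"
    if "L \<in> proj_lines" for L
    using that
  proof (cases rule: proj_lines_cases)
    case (1 a b)
    then show ?thesis
      using plucker_in_zero_locus_iff[OF 1(1-3) F] line_in_joining_lines_iff[OF lin disj 1(1-3)]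
        eq[of a b]
      by (simp only:)
  qed
  then show ?thesis using joining_lines_subset[OF disj] by blast
qed

section \<open>Explicit equations of the seven components\<close>

lemma add_sub_eq_zero_iff:
  fixes u v :: "'k::field_char_0"
  shows "u = 0 \<and> v = 0 \<longleftrightarrow> u + v = 0 \<and> u - v = 0"
  by auto

lemma hyperplane_simps:
  "hyperplane 1 = zero_locus {\<lambda>x. x $ 1 - x $ 2}" "hyperplane 2 = zero_locus {\<lambda>x. x $ 1 + x $ 2}"
  "hyperplane 3 = zero_locus {\<lambda>x. x $ 3 - x $ 4}" "hyperplane 4 = zero_locus {\<lambda>x. x $ 3 + x $ 4}"
  by (simp_all add: hyperplane_def numeral_eq_Suc)

lemma edge_simps:
  "edge 1 2 = zero_locus {\<lambda>x. x $ 1 - x $ 2, \<lambda>x. x $ 1 + x $ 2}"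
  "edge 3 4 = zero_locus {\<lambda>x. x $ 3 - x $ 4, \<lambda>x. x $ 3 + x $ 4}"
  "edge 2 3 = zero_locus {\<lambda>x. x $ 1 + x $ 2, \<lambda>x. x $ 3 - x $ 4}"
  "edge 1 4 = zero_locus {\<lambda>x. x $ 1 - x $ 2, \<lambda>x. x $ 3 + x $ 4}"
  "edge 1 3 = zero_locus {\<lambda>x. x $ 1 - x $ 2, \<lambda>x. x $ 3 - x $ 4}"
  "edge 2 4 = zero_locus {\<lambda>x. x $ 1 + x $ 2, \<lambda>x. x $ 3 + x $ 4}"
  unfolding edge_def hyperplane_simps zero_locus_Int by (simp_all only: insert_is_Un[symmetric])

lemma component_simps:
  "component 1 = zero_locus {\<lambda>m. M12 m, \<lambda>m. M13 m - M23 m, \<lambda>m. M14 m - M24 m}"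
  "component 2 = zero_locus {\<lambda>m. M12 m, \<lambda>m. M13 m + M23 m, \<lambda>m. M14 m + M24 m}"
  "component 3 = zero_locus {\<lambda>m. M34 m, \<lambda>m. M13 m - M14 m, \<lambda>m. M23 m - M24 m}"
  "component 4 = zero_locus {\<lambda>m. M34 m, \<lambda>m. M13 m + M14 m, \<lambda>m. M23 m + M24 m}"
  "component 5 = zero_locus {\<lambda>m. M12 m, \<lambda>m. M34 m, plucker_poly}"
  "component 6 = zero_locus {\<lambda>m. M14 m - M23 m, \<lambda>m. M13 m - M24 m, plucker_poly}"
  "component 7 = zero_locus {\<lambda>m. M14 m + M23 m, \<lambda>m. M13 m + M24 m, plucker_poly}"
  by (simp_all add: component_def numeral_eq_Suc)

text \<open>In each case the contraction has M12 (for \<open>i\<close> = 1, 2) or M34 (for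
  \<open>i\<close> = 3, 4), up to sign, at the two indices occurring in the form of the hyperplane.
  Its other two coordinates give the remaining two equations, up to sign.\<close>

lemma plucker_vimage_component_hyperplane:
  assumes "i \<in> {1..4}"
  shows "plucker -` component i \<inter> proj_lines
    = {L \<in> (proj_lines :: ('k::field ^ 4) set set set). L \<subseteq> hyperplane i}"
proof -
  have "i = 1 \<or> i = 2 \<or> i = 3 \<or> i = 4" using assms by auto
  then show ?thesis
  proof (elim disjE)
    assume i: "i = 1"
    show ?thesis
      unfolding i component_simps hyperplane_simps
    proof (rule plucker_vimage_hyperplane)
      fix a b :: "'k ^ 4"
      have eqs: "(a $ 1 - a $ 2) * b $ 1 - (b $ 1 - b $ 2) * a $ 1 = minor2 a b 1 2"
        "(a $ 1 - a $ 2) * b $ 2 - (b $ 1 - b $ 2) * a $ 2 = minor2 a b 1 2"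
        "(a $ 1 - a $ 2) * b $ 3 - (b $ 1 - b $ 2) * a $ 3 = minor2 a b 1 3 - minor2 a b 2 3"
        "(a $ 1 - a $ 2) * b $ 4 - (b $ 1 - b $ 2) * a $ 4 = minor2 a b 1 4 - minor2 a b 2 4"
        by (simp_all add: minor2_def algebra_simps)
      show "(\<forall>g\<in>{\<lambda>m. M12 m, \<lambda>m. M13 m - M23 m, \<lambda>m. M14 m - M24 m}.
          g (plucker_vec a b) = 0) \<longleftrightarrow>
          (\<forall>i. (a $ 1 - a $ 2) * b $ i - (b $ 1 - b $ 2) * a $ i = 0)"
        unfolding forall_4 eqs neg_equal_0_iff_equal by auto
    qed (auto intro: linear_form_coord)
  next
    assume i: "i = 2"
    show ?thesis
      unfolding i component_simps hyperplane_simps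
    proof (rule plucker_vimage_hyperplane)
      fix a b :: "'k ^ 4"
      have eqs: "(a $ 1 + a $ 2) * b $ 1 - (b $ 1 + b $ 2) * a $ 1 = - minor2 a b 1 2"
        "(a $ 1 + a $ 2) * b $ 2 - (b $ 1 + b $ 2) * a $ 2 = minor2 a b 1 2"
        "(a $ 1 + a $ 2) * b $ 3 - (b $ 1 + b $ 2) * a $ 3 = minor2 a b 1 3 + minor2 a b 2 3"
        "(a $ 1 + a $ 2) * b $ 4 - (b $ 1 + b $ 2) * a $ 4 = minor2 a b 1 4 + minor2 a b 2 4"
        by (simp_all add: minor2_def algebra_simps)
      show "(\<forall>g\<in>{\<lambda>m. M12 m, \<lambda>m. M13 m + M23 m, \<lambda>m. M14 m + M24 m}.
          g (plucker_vec a b) = 0) \<longleftrightarrow>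
          (\<forall>i. (a $ 1 + a $ 2) * b $ i - (b $ 1 + b $ 2) * a $ i = 0)"
        unfolding forall_4 eqs neg_equal_0_iff_equal by auto
    qed (auto intro: linear_form_coord)
  next
    assume i: "i = 3"
    show ?thesis
      unfolding i component_simps hyperplane_simps
    proof (rule plucker_vimage_hyperplane)
      fix a b :: "'k ^ 4"
      have eqs: "(a $ 3 - a $ 4) * b $ 1 - (b $ 3 - b $ 4) * a $ 1 = - (minor2 a b 1 3 - minor2 a b 1 4)"
        "(a $ 3 - a $ 4) * b $ 2 - (b $ 3 - b $ 4) * a $ 2 = - (minor2 a b 2 3 - minor2 a b 2 4)"
        "(a $ 3 - a $ 4) * b $ 3 - (b $ 3 - b $ 4) * a $ 3 = minor2 a b 3 4"
        "(a $ 3 - a $ 4) * b $ 4 - (b $ 3 - b $ 4) * a $ 4 = minor2 a b 3 4"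
        by (simp_all add: minor2_def algebra_simps)
      show "(\<forall>g\<in>{\<lambda>m. M34 m, \<lambda>m. M13 m - M14 m, \<lambda>m. M23 m - M24 m}.
          g (plucker_vec a b) = 0) \<longleftrightarrow>
          (\<forall>i. (a $ 3 - a $ 4) * b $ i - (b $ 3 - b $ 4) * a $ i = 0)"
        unfolding forall_4 eqs neg_equal_0_iff_equal by auto
    qed (auto intro: linear_form_coord)
  next
    assume i: "i = 4"
    show ?thesis
      unfolding i component_simps hyperplane_simps
    proof (rule plucker_vimage_hyperplane)
      fix a b :: "'k ^ 4"
      have eqs: "(a $ 3 + a $ 4) * b $ 1 - (b $ 3 + b $ 4) * a $ 1 = - (minor2 a b 1 3 + minor2 a b 1 4)"
        "(a $ 3 + a $ 4) * b $ 2 - (b $ 3 + b $ 4) * a $ 2 = - (minor2 a b 2 3 + minor2 a b 2 4)"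
        "(a $ 3 + a $ 4) * b $ 3 - (b $ 3 + b $ 4) * a $ 3 = - minor2 a b 3 4"
        "(a $ 3 + a $ 4) * b $ 4 - (b $ 3 + b $ 4) * a $ 4 = minor2 a b 3 4"
        by (simp_all add: minor2_def algebra_simps)
      show "(\<forall>g\<in>{\<lambda>m. M34 m, \<lambda>m. M13 m + M14 m, \<lambda>m. M23 m + M24 m}.
          g (plucker_vec a b) = 0) \<longleftrightarrow>
          (\<forall>i. (a $ 3 + a $ 4) * b $ i - (b $ 3 + b $ 4) * a $ i = 0)"
        unfolding forall_4 eqs neg_equal_0_iff_equal by auto
    qed (auto intro: linear_form_coord)
  qed
qed

lemma plucker_vimage_component_5:
  "plucker -` component 5 \<inter> (proj_lines :: ('k::field_char_0 ^ 4) set set set)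
    = joining_lines (edge 1 2) (edge 3 4)"
  unfolding component_simps edge_simps
proof (rule plucker_vimage_joining_lines)
  fix a b :: "'k ^ 4"
  \<comment> \<open>Each edge determinant is twice a single minor, and 2 is invertible in
    characteristic zero.\<close>
  have "(a $ i - a $ j) * (b $ i + b $ j) - (a $ i + a $ j) * (b $ i - b $ j)
      = 2 * minor2 a b i j" for i j
    by (simp add: minor2_def algebra_simps)
  then show "(\<forall>q\<in>{\<lambda>m. M12 m, \<lambda>m. M34 m, plucker_poly}. q (plucker_vec a b) = 0) \<longleftrightarrow>
      (a $ 1 - a $ 2) * (b $ 1 + b $ 2) - (a $ 1 + a $ 2) * (b $ 1 - b $ 2) = 0 \<and>
      (a $ 3 - a $ 4) * (b $ 3 + b $ 4) - (a $ 3 + a $ 4) * (b $ 3 - b $ 4) = 0"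
    by (simp only:) simp
qed ((rule linear_form_coord edges_disjoint(1)[unfolded edge_simps])+, auto intro: linear_form_coord)

lemma plucker_vimage_component_6:
  "plucker -` component 6 \<inter> (proj_lines :: ('k::field_char_0 ^ 4) set set set)
    = joining_lines (edge 2 3) (edge 1 4)"
  unfolding component_simps edge_simps
proof (rule plucker_vimage_joining_lines)
  fix a b :: "'k ^ 4"
  \<comment> \<open>The linear equations of the component are \<open>?u\<close> and
    \<open>?v\<close>; the determinants of the two edges are their difference and sum.\<close>
  let ?u = "minor2 a b 1 3 - minor2 a b 2 4" and ?v = "minor2 a b 1 4 - minor2 a b 2 3"
  have "(a $ 1 + a $ 2) * (b $ 3 - b $ 4) - (a $ 3 - a $ 4) * (b $ 1 + b $ 2) = ?u - ?v"
    "(a $ 1 - a $ 2) * (b $ 3 + b $ 4) - (a $ 3 + a $ 4) * (b $ 1 - b $ 2) = ?u + ?v"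
    by (simp_all add: minor2_def algebra_simps)
  then have "(a $ 1 + a $ 2) * (b $ 3 - b $ 4) - (a $ 3 - a $ 4) * (b $ 1 + b $ 2) = 0 \<and>
      (a $ 1 - a $ 2) * (b $ 3 + b $ 4) - (a $ 3 + a $ 4) * (b $ 1 - b $ 2) = 0 \<longleftrightarrow>
      ?u = 0 \<and> ?v = 0"
    \<comment> \<open>Passing to sum and difference loses nothing, since 2 is invertible.\<close>
    unfolding add_sub_eq_zero_iff[of ?u ?v] by (simp only: conj_commute)
  then show "(\<forall>q\<in>{\<lambda>m. M14 m - M23 m, \<lambda>m. M13 m - M24 m, plucker_poly}.
        q (plucker_vec a b) = 0) \<longleftrightarrow>
      (a $ 1 + a $ 2) * (b $ 3 - b $ 4) - (a $ 3 - a $ 4) * (b $ 1 + b $ 2) = 0 \<and>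
      (a $ 1 - a $ 2) * (b $ 3 + b $ 4) - (a $ 3 + a $ 4) * (b $ 1 - b $ 2) = 0"
    by auto
qed ((rule linear_form_coord edges_disjoint(2)[unfolded edge_simps])+, auto intro: linear_form_coord)

text \<open>This mirrors the sixth component: changing the sign of the second coordinate exchanges
  the first two hyperplanes and flips the signs of M12, M23 and M24.\<close>

lemma plucker_vimage_component_7:
  "plucker -` component 7 \<inter> (proj_lines :: ('k::field_char_0 ^ 4) set set set)
    = joining_lines (edge 1 3) (edge 2 4)"
  unfolding component_simps edge_simps
proof (rule plucker_vimage_joining_lines)
  fix a b :: "'k ^ 4"
  let ?u = "minor2 a b 1 3 + minor2 a b 2 4" and ?v = "minor2 a b 1 4 + minor2 a b 2 3"
  have "(a $ 1 - a $ 2) * (b $ 3 - b $ 4) - (a $ 3 - a $ 4) * (b $ 1 - b $ 2) = ?u - ?v"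
    "(a $ 1 + a $ 2) * (b $ 3 + b $ 4) - (a $ 3 + a $ 4) * (b $ 1 + b $ 2) = ?u + ?v"
    by (simp_all add: minor2_def algebra_simps)
  then have "(a $ 1 - a $ 2) * (b $ 3 - b $ 4) - (a $ 3 - a $ 4) * (b $ 1 - b $ 2) = 0 \<and>
      (a $ 1 + a $ 2) * (b $ 3 + b $ 4) - (a $ 3 + a $ 4) * (b $ 1 + b $ 2) = 0 \<longleftrightarrow>
      ?u = 0 \<and> ?v = 0"
    unfolding add_sub_eq_zero_iff[of ?u ?v] by (simp only: conj_commute)
  then show "(\<forall>q\<in>{\<lambda>m. M14 m + M23 m, \<lambda>m. M13 m + M24 m, plucker_poly}.
        q (plucker_vec a b) = 0) \<longleftrightarrow>
      (a $ 1 - a $ 2) * (b $ 3 - b $ 4) - (a $ 3 - a $ 4) * (b $ 1 - b $ 2) = 0 \<and>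
      (a $ 1 + a $ 2) * (b $ 3 + b $ 4) - (a $ 3 + a $ 4) * (b $ 1 + b $ 2) = 0"
    by auto
qed ((rule linear_form_coord edges_disjoint(3)[unfolded edge_simps])+, auto intro: linear_form_coord)

theorem theorem4p2p4:
  shows "(\<forall>i \<in> {1..4}.
            plucker -` component i \<inter> proj_lines
              = {L \<in> (proj_lines :: ('k::{alg_closed_field, field_char_0} ^ 4) set set set).
                   L \<subseteq> hyperplane i}) \<and>
         plucker -` component 5 \<inter> (proj_lines :: ('k ^ 4) set set set)
           = joining_lines (edge 1 2) (edge 3 4) \<and>
         plucker -` component 6 \<inter> (proj_lines :: ('k ^ 4) set set set)
           = joining_lines (edge 2 3) (edge 1 4) \<and>
         plucker -` component 7 \<inter> (proj_lines :: ('k ^ 4) set set set)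
           = joining_lines (edge 1 3) (edge 2 4)"
  by (intro conjI ballI plucker_vimage_component_hyperplane plucker_vimage_component_5
      plucker_vimage_component_6 plucker_vimage_component_7)

end
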